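(* Consider the saturated switched system $x(t+1)=A_{\sigma(t)}x(t)+B_{\sigma(t)}\,\mathrm{sat}(K_{\sigma(t)}x(t))$, $t\in\mathbb{Z}^+$, with $\sigma(t)\in\mathcal{I}_N=\{1,\dots,N\}$. Suppose that for some integer $\tau\ge1$ there exist symmetric positive definite matrices $P_i\succ0$ and matrices $H_{i,1},H_{i,2},\dots,H_{i,\tau}\in\mathbb{R}^{m\times n}$ for each $i\in\mathcal{I}_N$ such that, with the functions $E_i^t$ defined in the context from these $H_{i,t}$ (and $E_i=E_i^1$), $$E_i(x,S_1)^TP_iE_i(x,S_1)-x^TP_ix<0\qquad\forall x\neq0,\ \forall i\in\mathcal{I}_N,\ \forall S_1\in\mathcal{V}_m,$$ $$E_i^{\tau}(x,S_1,\dots,S_\tau)^TP_jE_i^{\tau}(x,S_1,\dots,S_\tau)-x^TP_ix<0\qquad\forall x\neq0,\ \forall i\neq j\in\mathcal{I}_N,\ \forall S_1,\dots,S_\tau\in\mathcal{V}_m,$$ $$\mathcal{E}(P_i)\subseteq\mathcal{L}(H_{i,t})\qquad\forall i\in\mathcal{I}_N,\ t=1,2,\dots,\tau.$$ Then: (i) the origin of the saturated switched system with dwell-time $\tau$ is locally asymptotically stable; (ii) the set $\Psi:=\bigcap_{i\in\mathcal{I}_N}\mathcal{E}(P_i)$ is contained in the domain of attraction of the saturated switched system with dwell-time $\tau$.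
   Context: Here $x\in\mathbb{R}^n$, $A_i\in\mathbb{R}^{n\times n}$, $B_i\in\mathbb{R}^{n\times m}$, $K_i\in\mathbb{R}^{m\times n}$ for $i\in\mathcal{I}_N$, and $\mathbb{Z}^+$ is the set of non-negative integers. The saturation function $\mathrm{sat}:\mathbb{R}^m\to\mathbb{R}^m$ acts componentwise: $\mathrm{sat}(u)_j=\mathrm{sgn}(u_j)\min\{1,|u_j|\}$. Notation: $\mathcal{V}_m$ is the set of all subsets of $\{1,\dots,m\}$ (including the empty set); for $S\in\mathcal{V}_m$, $S^c=\{1,\dots,m\}\setminus S$. For a matrix $Y$, $Y^{i\bullet}$ is its $i$-th row and $Y^{\bullet j}$ its $j$-th column. $\mathcal{E}(P)=\{x\in\mathbb{R}^n: x^TPx\le1\}$ and $\mathcal{L}(H)=\{x\in\mathbb{R}^n:\|Hx\|_\infty\le1\}$. The functions $E_i^t$: for $i\in\mathcal{I}_N$, $x\in\mathbb{R}^n$, $S_1,S_2,\dots\in\mathcal{V}_m$, $$E_i(x,S_1)=E_i^1(x,S_1)=\Big(A_i+\sum_{j\in S_1^c}B_i^{\bullet j}K_i^{j\bullet}\Big)x+\Big(\sum_{j\in S_1}B_i^{\bullet j}H_{i,1}^{j\bullet}\Big)x,$$ and recursively for $2\le t\le\tau$ (the last term involves the original $x$) $$E_i^t(x,S_1,\dots,S_t)=\Big(A_i+\sum_{j\in S_t^c}B_i^{\bullet j}K_i^{j\bullet}\Big)E_i^{t-1}(x,S_1,\dots,S_{t-1})+\Big(\sum_{j\in S_t}B_i^{\bullet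 j}H_{i,t}^{j\bullet}\Big)x.$$ Dwell time: the switching signal $\sigma:\mathbb{Z}^+\to\mathcal{I}_N$ has switching instants $t_0=0<t_1<t_2<\cdots$ (the signal is constant on each $[t_k,t_{k+1})$ and changes value at $t_1,t_2,\dots$). It is dwell-time admissible (DT-admissible) with dwell-time $\tau$ if $t_{k+1}-t_k\ge\tau$ for all $k\in\mathbb{Z}^+$. Local asymptotic stability of the origin with dwell-time $\tau$ means local asymptotic stability under every switching signal that is DT-admissible with dwell-time $\tau$; the domain of attraction is the set of initial states $x(0)$ from which $x(t)\to0$ as $t\to\infty$ under every such switching signal. Standing assumptions: (A1) for every $i\in\mathcal{I}_N$ all eigenvalues of $A_i+B_iK_i$ lie strictly inside the unit disc; (A2) a value of $\tau\ge1$ has been identified for which the unsaturated switched system $x(t+1)=(A_{\sigma(t)}+B_{\sigma(t)}K_{\sigma(t)})x(t)$ is asymptotically stable with dwell-time $\tau$. *)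

theory Defs
  imports "HOL-Analysis.Analysis"
begin

definition sat :: "real^'m \<Rightarrow> real^'m" where
  "sat u = (\<chi> j. sgn (u $ j) * min 1 \<bar>u $ j\<bar>)"

(* Column times row. *)
definition outer :: "real^'n \<Rightarrow> real^'k \<Rightarrow> real^'k^'n" where
  "outer u v = (\<chi> a b. u $ a * v $ b)"

definition sym_pos_def :: "real^'n^'n \<Rightarrow> bool" where
  "sym_pos_def P \<longleftrightarrow> transpose P = P \<and> (\<forall>x. x \<noteq> 0 \<longrightarrow> 0 < x \<bullet> (P *v x))"

(* All (complex) eigenvalues lie strictly inside the unit disc. *)
definition schur_stable :: "real^'n^'n \<Rightarrow> bool" where
  "schur_stable M \<longleftrightarrow>
     (\<forall>(l::complex) (v::complex^'n).
        v \<noteq> 0 \<longrightarrow> map_matrix complex_of_real M *v v = l *s v \<longrightarrow> cmod l < 1)"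

definition ellipsoid :: "real^'n^'n \<Rightarrow> (real^'n) set" where
  "ellipsoid P = {x. x \<bullet> (P *v x) \<le> 1}"

definition lin_region :: "real^'n^'m \<Rightarrow> (real^'n) set" where
  "lin_region H = {x. infnorm (H *v x) \<le> 1}"

(* The subsystems are indexed by {1..N}. A switched system x(t+1) = f (sigma t) (x t)
   is given by the family f of its right-hand sides. *)

primrec trajectory :: "(nat \<Rightarrow> 'x \<Rightarrow> 'x) \<Rightarrow> (nat \<Rightarrow> nat) \<Rightarrow> 'x \<Rightarrow> nat \<Rightarrow> 'x" where
  "trajectory f \<sigma> x0 0 = x0"
| "trajectory f \<sigma> x0 (Suc t) = f (\<sigma> t) (trajectory f \<sigma> x0 t)"

definition switching_instants :: "(nat \<Rightarrow> nat) \<Rightarrow> nat set" where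
  "switching_instants \<sigma> = insert 0 {t. 0 < t \<and> \<sigma> t \<noteq> \<sigma> (t - 1)}"

(* s and t range over consecutive switching instants. The set of switching instants may be
   finite, so signals that are eventually constant are included. *)
definition dt_admissible :: "nat \<Rightarrow> nat \<Rightarrow> (nat \<Rightarrow> nat) \<Rightarrow> bool" where
  "dt_admissible N \<tau> \<sigma> \<longleftrightarrow>
     (\<forall>t. \<sigma> t \<in> {1..N}) \<and>
     (\<forall>s \<in> switching_instants \<sigma>. \<forall>t \<in> switching_instants \<sigma>.
        s < t \<and> {s<..<t} \<inter> switching_instants \<sigma> = {} \<longrightarrow> \<tau> \<le> t - s)"

(* Lyapunov stability and local attractivity of the origin, for one fixed signal and
   initial time 0. *)
definition loc_asymp_stable ::
    "(nat \<Rightarrow> 'x::real_normed_vector \<Rightarrow> 'x) \<Rightarrow> (nat \<Rightarrow> nat) \<Rightarrow> bool" where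
  "loc_asymp_stable f \<sigma> \<longleftrightarrow>
     (\<forall>\<epsilon>>0. \<exists>\<delta>>0. \<forall>x0. norm x0 < \<delta> \<longrightarrow> (\<forall>t. norm (trajectory f \<sigma> x0 t) < \<epsilon>)) \<and>
     (\<exists>\<delta>>0. \<forall>x0. norm x0 < \<delta> \<longrightarrow> trajectory f \<sigma> x0 \<longlonglongrightarrow> 0)"

definition dt_loc_asymp_stable ::
    "nat \<Rightarrow> nat \<Rightarrow> (nat \<Rightarrow> 'x::real_normed_vector \<Rightarrow> 'x) \<Rightarrow> bool" where
  "dt_loc_asymp_stable N \<tau> f \<longleftrightarrow> (\<forall>\<sigma>. dt_admissible N \<tau> \<sigma> \<longrightarrow> loc_asymp_stable f \<sigma>)"

definition dt_domain_of_attraction ::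
    "nat \<Rightarrow> nat \<Rightarrow> (nat \<Rightarrow> 'x::real_normed_vector \<Rightarrow> 'x) \<Rightarrow> 'x set" where
  "dt_domain_of_attraction N \<tau> f =
     {x0. \<forall>\<sigma>. dt_admissible N \<tau> \<sigma> \<longrightarrow> trajectory f \<sigma> x0 \<longlonglongrightarrow> 0}"

definition sat_system ::
    "(nat \<Rightarrow> real^'n^'n) \<Rightarrow> (nat \<Rightarrow> real^'m^'n) \<Rightarrow> (nat \<Rightarrow> real^'n^'m) \<Rightarrow>
     nat \<Rightarrow> real^'n \<Rightarrow> real^'n" where
  "sat_system A B K i x = A i *v x + B i *v sat (K i *v x)"

definition unsat_system ::
    "(nat \<Rightarrow> real^'n^'n) \<Rightarrow> (nat \<Rightarrow> real^'m^'n) \<Rightarrow> (nat \<Rightarrow> real^'n^'m) \<Rightarrow>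
     nat \<Rightarrow> real^'n \<Rightarrow> real^'n" where
  "unsat_system A B K i x = (A i + B i ** K i) *v x"

(* E_fun A B K H i t x S is E_i^t(x, S 1, ..., S t); the recursion is started at t = 0 with x,
   so that its first step gives E_i^1. *)
primrec E_fun ::
    "(nat \<Rightarrow> real^'n^'n) \<Rightarrow> (nat \<Rightarrow> real^'m^'n) \<Rightarrow> (nat \<Rightarrow> real^'n^'m) \<Rightarrow>
     (nat \<Rightarrow> nat \<Rightarrow> real^'n^'m) \<Rightarrow>
     nat \<Rightarrow> nat \<Rightarrow> real^'n \<Rightarrow> (nat \<Rightarrow> 'm set) \<Rightarrow> real^'n" where
  "E_fun A B K H i 0 x S = x"
| "E_fun A B K H i (Suc t) x S =
     (A i + (\<Sum>j \<in> - S (Suc t). outer (column j (B i)) (row j (K i)))) *v E_fun A B K H i t x S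
     + (\<Sum>j \<in> S (Suc t). outer (column j (B i)) (row j (H i (Suc t)))) *v x"

end

theory Submission
  imports Defs
begin

text \<open>
  The quadratic forms \<open>V\<^sub>i x = x \<bullet> (P i *v x)\<close> act as a switched Lyapunov function: along a
  trajectory \<open>x\<close> of the saturated system the quantity \<open>W t = V\<^bsub>\<sigma> t\<^esub> (x t)\<close> is studied.

  Saturation is replaced by convexity. If every coordinate of \<open>v\<close> has modulus at most one, then
  each coordinate of \<open>sat u\<close> lies between those of \<open>u\<close> and \<open>v\<close>, so \<open>sat u\<close> is a convex combination
  of the vectors that mix the coordinates of \<open>u\<close> and \<open>v\<close> (\<open>box_subset_convex\<close>). Take \<open>u = K i *v y\<close>
  at the current state \<open>y\<close> and \<open>v = H i s *v x\<close> at the starting state \<open>x\<close>, which is admissible since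
  \<open>x\<close> lies in the ellipsoid of \<open>P i\<close>. By induction, the state after \<open>t\<close> steps in mode \<open>i\<close> is a convex
  combination of the points \<open>E\<^sup>t x S\<close> (\<open>sat_iterate_in_convex\<close>). A bound on \<open>V\<^sub>j\<close> at all of these points
  therefore holds at the state itself.

  The points \<open>E\<^sup>t x S\<close> are linear in \<open>x\<close> and only finitely many choices of \<open>S\<close> matter, so
  compactness of the unit sphere turns the strict inequalities of the hypothesis into contractions
  with a common factor \<open>c < 1\<close>: over one step without a change of mode, and over \<open>\<tau>\<close> steps in a mode
  that is left at the end (\<open>sat_iterate_contracting\<close>).

  A dwell time of \<open>\<tau>\<close> says that the \<open>\<tau>\<close> steps before any switch are spent in one mode. Hence each
  \<open>W t\<close> with \<open>t > 0\<close> is bounded by \<open>c * W (t - 1)\<close> or by \<open>c * W (t - \<tau>)\<close>, and in both cases strong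
  induction gives \<open>W t \<le> \<mu> ^ t * W 0\<close> with \<open>\<mu> = root \<tau> c\<close> (\<open>dwell_time_decay\<close>). The bound keeps \<open>W\<close>
  at most one, inside the ellipsoids where the contractions are valid. It holds for any initial
  state in the intersection of the ellipsoids, in particular near the origin, and as all \<open>V\<^sub>i\<close> are
  comparable with the squared norm it yields both stability and attraction.
\<close>

section \<open>Quadratic forms\<close>

abbreviation quad :: "real^'n^'n \<Rightarrow> real^'n \<Rightarrow> real" where
  "quad M x \<equiv> x \<bullet> (M *v x)"

lemma quad_nonneg:
  assumes "sym_pos_def M"
  shows "0 \<le> quad M x"
  using assms by (cases "x = 0") (auto simp: sym_pos_def_def intro: less_imp_le)

lemma quad_scaleR: "quad M (c *\<^sub>R x) = c\<^sup>2 * quad M x"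
  by (simp add: matrix_vector_mult_scaleR power2_eq_square)

lemma continuous_on_quad: "continuous_on S (quad M)"
  by (intro continuous_intros matrix_vector_mult_linear_continuous_on)

lemma convex_quad_sublevel:
  fixes M :: "real^'n^'n"
  assumes "sym_pos_def M"
  shows "convex {x. quad M x \<le> c}"
proof (rule convexI, safe)
  fix x y :: "real^'n" and u v :: real
  assume x: "quad M x \<le> c" and y: "quad M y \<le> c" and uv: "0 \<le> u" "0 \<le> v" "u + v = 1"
  have sym: "y \<bullet> (M *v x) = x \<bullet> (M *v y)"
    using assms by (metis sym_pos_def_def dot_lmul_matrix inner_commute transpose_matrix_vector)
  have "u * quad M x + v * quad M y - quad M (u *\<^sub>R x + v *\<^sub>R y) = u * v * quad M (x - y)"
  proof -
    have v: "v = 1 - u" using uv by simp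
    show ?thesis
      unfolding v
      by (simp add: matrix_vector_mult_scaleR matrix_vector_right_distrib
          matrix_vector_mult_diff_distrib inner_add_left inner_add_right inner_diff_left
          inner_diff_right sym algebra_simps)
  qed
  moreover have "0 \<le> u * v * quad M (x - y)"
    using uv quad_nonneg[OF assms] by simp
  moreover have "u * quad M x + v * quad M y \<le> u * c + v * c"
    using uv x y by (intro add_mono mult_left_mono) auto
  ultimately show "quad M (u *\<^sub>R x + v *\<^sub>R y) \<le> c"
    using uv by (simp flip: distrib_right)
qed

text \<open>Both functions are homogeneous of degree two, so their quotient is constant on rays and
  attains its maximum on the unit sphere. This single fact turns strict inequalities into
  inequalities with a factor below one, and compares quadratic forms with the norm.\<close>

lemma homogeneous_ratio_attained:
  fixes p r :: "real^'n \<Rightarrow> real"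
  assumes "continuous_on UNIV p" "continuous_on UNIV r"
    and hom: "\<And>c x. p (c *\<^sub>R x) = c\<^sup>2 * p x" "\<And>c x. r (c *\<^sub>R x) = c\<^sup>2 * r x"
    and pos: "\<And>x. x \<noteq> 0 \<Longrightarrow> 0 < p x"
  obtains z where "norm z = 1" "\<And>x. r x \<le> r z / p z * p x"
proof -
  let ?B = "sphere (0::real^'n) 1"
  have "p x \<noteq> 0" if "x \<in> ?B" for x
    using pos[of x] that by fastforce
  then have "continuous_on ?B (\<lambda>x. r x / p x)"
    by (intro continuous_on_divide continuous_on_subset[OF assms(1)]
        continuous_on_subset[OF assms(2)]) auto
  moreover have "?B \<noteq> {}" by simp
  ultimately obtain z where z: "z \<in> ?B" "\<And>x. x \<in> ?B \<Longrightarrow> r x / p x \<le> r z / p z"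
    using continuous_attains_sup[of ?B "\<lambda>x. r x / p x"] by auto
  have "r x \<le> r z / p z * p x" for x
  proof (cases "x = 0")
    case True
    then show ?thesis using hom(1)[of 0 0] hom(2)[of 0 0] by simp
  next
    case False
    let ?y = "x /\<^sub>R norm x"
    have "0 < p ?y" "r ?y \<le> r z / p z * p ?y"
      using pos[of ?y] z(2)[of ?y] False by (simp_all add: pos_divide_le_eq)
    then have "(norm x)\<^sup>2 * r ?y \<le> (norm x)\<^sup>2 * (r z / p z * p ?y)"
      by (intro mult_left_mono) auto
    moreover have "r x = (norm x)\<^sup>2 * r ?y" "p x = (norm x)\<^sup>2 * p ?y"
      using False by (simp_all flip: hom)
    ultimately show ?thesis by (simp add: algebra_simps)
  qed
  with z(1) that show thesis by simp
qed

lemma quad_norm_equivalent: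
  fixes M :: "real^'n^'n"
  assumes "sym_pos_def M"
  shows "\<exists>c\<in>{0<..}. \<forall>x. (norm x)\<^sup>2 \<le> c * quad M x" "\<exists>c\<in>{0<..}. \<forall>x. quad M x \<le> c * (norm x)\<^sup>2"
proof -
  have pos: "\<And>x. x \<noteq> 0 \<Longrightarrow> 0 < quad M x"
    using assms by (simp add: sym_pos_def_def)
  have cont: "continuous_on UNIV (\<lambda>x::real^'n. (norm x)\<^sup>2)"
    by (intro continuous_intros)
  have hom: "\<And>c x. (norm (c *\<^sub>R (x::real^'n)))\<^sup>2 = c\<^sup>2 * (norm x)\<^sup>2"
    by (simp add: power_mult_distrib)
  obtain y where "norm y = 1" "\<And>x. (norm x)\<^sup>2 \<le> (norm y)\<^sup>2 / quad M y * quad M x"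
    using homogeneous_ratio_attained[OF continuous_on_quad[of _ M] cont quad_scaleR hom pos]
    by blast
  then show "\<exists>c\<in>{0<..}. \<forall>x. (norm x)\<^sup>2 \<le> c * quad M x"
    using pos[of y] by (intro bexI[of _ "(norm y)\<^sup>2 / quad M y"]) force+
  obtain z where "norm z = 1" "\<And>x. quad M x \<le> quad M z / (norm z)\<^sup>2 * (norm x)\<^sup>2"
    using homogeneous_ratio_attained[OF cont continuous_on_quad[of _ M] hom quad_scaleR] by auto
  then show "\<exists>c\<in>{0<..}. \<forall>x. quad M x \<le> c * (norm x)\<^sup>2"
    using pos[of z] by (intro bexI[of _ "quad M z / (norm z)\<^sup>2"]) force+
qed

lemma strict_decrease_imp_contraction:
  fixes M Q :: "real^'n^'n" and L :: "real^'n \<Rightarrow> real^'n"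
  assumes "sym_pos_def M" and Q: "sym_pos_def Q" and "linear L"
    and dec: "\<And>x. x \<noteq> 0 \<Longrightarrow> quad Q (L x) < quad M x"
  shows "\<exists>c\<in>{0<..<1}. \<forall>x. quad Q (L x) \<le> c * quad M x"
proof -
  have pos: "\<And>x. x \<noteq> 0 \<Longrightarrow> 0 < quad M x"
    using assms(1) by (simp add: sym_pos_def_def)
  have cont: "continuous_on UNIV (\<lambda>x. quad Q (L x))"
    using continuous_on_compose2[OF continuous_on_quad[of UNIV Q], of UNIV L]
      linear_continuous_on \<open>linear L\<close> linear_conv_bounded_linear by blast
  have hom: "\<And>c x. quad Q (L (c *\<^sub>R x)) = c\<^sup>2 * quad Q (L x)"
    by (simp only: linear_scale[OF \<open>linear L\<close>] quad_scaleR)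
  obtain z where z: "norm z = 1" "\<And>x. quad Q (L x) \<le> quad Q (L z) / quad M z * quad M x"
    using homogeneous_ratio_attained[OF continuous_on_quad[of _ M] cont quad_scaleR hom pos] by blast
  let ?c = "quad Q (L z) / quad M z"
  have "z \<noteq> 0" using z(1) by auto
  then have c: "?c < 1" using dec[of z] pos[of z] by (simp add: divide_less_eq)
  \<comment> \<open>The maximal ratio may be zero, and the factor is wanted positive.\<close>
  have "quad Q (L x) \<le> max ?c (1/2) * quad M x" for x
    using z(2)[of x] mult_right_mono[OF max.cobounded1 quad_nonneg[OF assms(1)], of ?c x "1/2"]
    by linarith
  then show ?thesis
    using c by (intro bexI[of _ "max ?c (1/2)"]) auto
qed

lemma finite_uniform_constant:
  fixes D :: "'c::linorder set"
  assumes "finite I" "D \<noteq> {}"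
    and "\<And>i. i \<in> I \<Longrightarrow> \<exists>c\<in>D. R i c"
    and mono: "\<And>i c d. i \<in> I \<Longrightarrow> R i c \<Longrightarrow> c \<le> d \<Longrightarrow> R i d"
  shows "\<exists>c\<in>D. \<forall>i\<in>I. R i c"
proof -
  obtain c where c: "\<And>i. i \<in> I \<Longrightarrow> c i \<in> D \<and> R i (c i)"
    using assms(3) by metis
  show ?thesis
  proof (cases "I = {}")
    case False
    have "Max (c ` I) \<in> c ` I" using assms(1) False by simp
    then have "Max (c ` I) \<in> D" using c by auto
    moreover have "R i (Max (c ` I))" if "i \<in> I" for i
      using mono[OF that, of "c i"] c[OF that] assms(1) that by auto
    ultimately show ?thesis by blast
  qed (use \<open>D \<noteq> {}\<close> in auto)
qed

section \<open>Saturation as a convex combination of linear feedbacks\<close>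

lemma convex_affine_vimage:
  assumes "convex C"
    and affine: "\<And>a b x y. a + b = 1 \<Longrightarrow> f (a *\<^sub>R x + b *\<^sub>R y) = a *\<^sub>R f x + b *\<^sub>R f y"
  shows "convex (f -` C)"
  using assms by (auto simp: convex_def)

text \<open>Interpolating one coordinate at a time: the points whose coordinates in \<open>J\<close> are already
  those of \<open>w\<close> and whose other coordinates are still free choices between \<open>u\<close> and \<open>v\<close> lie in \<open>C\<close>.\<close>

lemma box_subset_convex:
  fixes u v w :: "real^'m"
  assumes C: "convex C"
    and vertices: "\<And>S. (\<chi> j. if j \<in> S then v $ j else u $ j) \<in> C"
    and w: "\<And>j. w $ j \<in> closed_segment (u $ j) (v $ j)"
  shows "w \<in> C"
proof -
  have "finite J \<Longrightarrow> (\<chi> j. if j \<in> J then w $ j else if j \<in> S then v $ j else u $ j) \<in> C" for J S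
  proof (induction J arbitrary: S rule: finite_induct)
    case empty
    then show ?case using vertices by simp
  next
    case (insert k J)
    let ?p = "\<lambda>S. \<chi> j. if j \<in> J then w $ j else if j \<in> S then v $ j else u $ j"
    obtain c where c: "w $ k = (1 - c) * u $ k + c * v $ k" "0 \<le> c" "c \<le> 1"
      using w[of k] by (auto simp: closed_segment_def)
    have "(1 - c) *\<^sub>R ?p (S - {k}) + c *\<^sub>R ?p (insert k S) \<in> C"
      using insert.IH c by (intro convexD[OF C]) auto
    moreover have "(1 - c) *\<^sub>R ?p (S - {k}) + c *\<^sub>R ?p (insert k S)
        = (\<chi> j. if j \<in> insert k J then w $ j else if j \<in> S then v $ j else u $ j)"
      using insert.hyps c by (auto simp: vec_eq_iff algebra_simps)
    ultimately show ?case by simp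
  qed
  from this[of UNIV] show ?thesis by simp
qed

lemma sat_in_closed_segment:
  assumes "\<bar>v $ j\<bar> \<le> 1"
  shows "sat u $ j \<in> closed_segment (u $ j) (v $ j)"
  using assms by (auto simp: sat_def closed_segment_eq_real_ivl sgn_if min_def)

lemma sum_outer_mult_vec:
  "(\<Sum>j\<in>S. outer (column j M) (row j L)) *v x = M *v (\<chi> j. if j \<in> S then (L *v x) $ j else 0)"
proof -
  have outer: "outer (column j M) (row j L) *v x = (L *v x) $ j *\<^sub>R column j M" for j
    by (simp add: vec_eq_iff outer_def matrix_vector_mult_def column_def row_def
        sum_distrib_left sum_distrib_right mult_ac)
  have "(\<Sum>j\<in>S. outer (column j M) (row j L)) *v x
      = (\<Sum>j\<in>S. outer (column j M) (row j L) *v x)"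
    by (induction S rule: infinite_finite_induct) (auto simp: matrix_vector_mult_add_rdistrib)
  also have "\<dots> = (\<Sum>j\<in>UNIV. (if j \<in> S then (L *v x) $ j else 0) *\<^sub>R column j M)"
    unfolding outer by (intro sum.mono_neutral_cong_left) auto
  also have "\<dots> = M *v (\<chi> j. if j \<in> S then (L *v x) $ j else 0)"
    by (simp add: matrix_mult_sum scalar_mult_eq_scaleR)
  finally show ?thesis .
qed

text \<open>One step of the recursion for \<open>E_fun\<close> applies \<open>B i\<close> to a vertex of the box with opposite
  corners \<open>K i *v y\<close> and \<open>H i (Suc t) *v x\<close>, where \<open>y\<close> is the current point.\<close>

lemma E_fun_Suc_vertex:
  "E_fun A B K H i (Suc t) x S = A i *v E_fun A B K H i t x S
     + B i *v (\<chi> j. if j \<in> S (Suc t) then (H i (Suc t) *v x) $ j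
                     else (K i *v E_fun A B K H i t x S) $ j)"
proof -
  have "B i *v (\<chi> j. if j \<in> - S (Suc t) then (K i *v y) $ j else 0)
      + B i *v (\<chi> j. if j \<in> S (Suc t) then (H i (Suc t) *v x) $ j else 0)
      = B i *v (\<chi> j. if j \<in> S (Suc t) then (H i (Suc t) *v x) $ j else (K i *v y) $ j)" for y
    unfolding matrix_vector_right_distrib[symmetric]
    by (rule arg_cong[where f = "(*v) (B i)"]) (auto simp: vec_eq_iff)
  then show ?thesis
    by (simp only: E_fun.simps matrix_vector_mult_add_rdistrib sum_outer_mult_vec add.assoc)
qed

lemma E_fun_cong:
  assumes "\<And>s. s \<in> {1..t} \<Longrightarrow> S s = S' s"
  shows "E_fun A B K H i t x S = E_fun A B K H i t x S'"
  using assms by (induction t) simp_all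

lemma linear_E_fun: "linear (\<lambda>x. E_fun A B K H i t x S)"
proof (induction t)
  case 0
  then show ?case by (simp add: linear_iff)
next
  case (Suc t)
  have "linear ((*v) M \<circ> (\<lambda>x. E_fun A B K H i t x S))" for M :: "real^'a^'a"
    by (intro linear_compose Suc) simp
  then show ?case
    by (simp add: linear_compose_add o_def)
qed

lemma finite_E_fun_maps:
  fixes K :: "nat \<Rightarrow> real^'n^'m"
  shows "finite (range (\<lambda>S x. E_fun A B K H i t x S))"
proof (rule finite_subset)
  show "range (\<lambda>S x. E_fun A B K H i t x S)
      \<subseteq> (\<lambda>S x. E_fun A B K H i t x S) ` ({1..t} \<rightarrow>\<^sub>E (UNIV :: 'm set set))"
  proof safe
    fix S
    have "(\<lambda>x. E_fun A B K H i t x S) = (\<lambda>x. E_fun A B K H i t x (restrict S {1..t}))"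
      by (intro ext E_fun_cong) simp
    then show "(\<lambda>x. E_fun A B K H i t x S)
        \<in> (\<lambda>S x. E_fun A B K H i t x S) ` ({1..t} \<rightarrow>\<^sub>E (UNIV :: 'm set set))"
      by (rule image_eqI[of _ "\<lambda>S x. E_fun A B K H i t x S"]) auto
  qed
qed (simp add: finite_PiE)

text \<open>Each saturated input lies in a box whose corners depend affinely on the current state, so
  one step of the saturated system maps a convex combination of the points \<open>E\<^sup>t\<close> to a convex
  combination of the points \<open>E\<^bsup>t+1\<^esup>\<close>. Quantifying over all convex sets \<open>C\<close> amounts to membership
  in the convex hull, and makes the induction step a matter of affine preimages.\<close>

lemma sat_iterate_in_convex:
  fixes K :: "nat \<Rightarrow> real^'n^'m"
  assumes "\<And>s. s \<in> {1..t} \<Longrightarrow> x \<in> lin_region (H i s)"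
    and "convex C" "\<And>S. E_fun A B K H i t x S \<in> C"
  shows "(sat_system A B K i ^^ t) x \<in> C"
  using assms
proof (induction t arbitrary: C)
  case 0
  then show ?case by simp
next
  case (Suc t)
  define vertex where "vertex S y = (\<chi> j. if j \<in> S then (H i (Suc t) *v x) $ j else (K i *v y) $ j)"
    for S y
  let ?y = "(sat_system A B K i ^^ t) x"
  have "A i *v ?y + B i *v vertex S ?y \<in> C" for S
  proof -
    let ?g = "\<lambda>y. A i *v y + B i *v vertex S y"
    have affine: "vertex S (a *\<^sub>R y + b *\<^sub>R z) = a *\<^sub>R vertex S y + b *\<^sub>R vertex S z"
      if "a + b = 1" for a b y z
      using that by (auto simp: vertex_def vec_eq_iff matrix_vector_right_distrib
          matrix_vector_mult_scaleR simp flip: distrib_right)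
    have "convex (?g -` C)"
      using \<open>convex C\<close>
      by (rule convex_affine_vimage) (simp add: affine matrix_vector_right_distrib
          matrix_vector_mult_scaleR scaleR_add_right)
    moreover have "E_fun A B K H i t x S' \<in> ?g -` C" for S'
    proof -
      \<comment> \<open>The first \<open>t\<close> index sets come from \<open>S'\<close>, and \<open>S\<close> is the next one.\<close>
      have "E_fun A B K H i t x (S'(Suc t := S)) = E_fun A B K H i t x S'"
        by (rule E_fun_cong) simp
      then show ?thesis
        using Suc.prems(3)[of "S'(Suc t := S)"]
        by (simp only: E_fun_Suc_vertex vertex_def vimage_eq fun_upd_same)
    qed
    ultimately have "?y \<in> ?g -` C"
      using Suc.prems(1) by (intro Suc.IH) auto
    then show ?thesis by simp
  qed
  then have vertices: "(\<chi> j. if j \<in> S then (H i (Suc t) *v x) $ j else (K i *v ?y) $ j)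
      \<in> (\<lambda>w. A i *v ?y + B i *v w) -` C" for S
    by (simp add: vertex_def)
  have "sat (K i *v ?y) \<in> (\<lambda>w. A i *v ?y + B i *v w) -` C"
  proof (rule box_subset_convex[OF _ vertices])
    have "A i *v ?y + B i *v (a *\<^sub>R w + b *\<^sub>R z)
        = a *\<^sub>R (A i *v ?y + B i *v w) + b *\<^sub>R (A i *v ?y + B i *v z)" if "a + b = 1" for a b w z
    proof -
      have "A i *v ?y = a *\<^sub>R (A i *v ?y) + b *\<^sub>R (A i *v ?y)"
        by (simp add: that flip: scaleR_add_left)
      then show ?thesis
        by (simp add: matrix_vector_right_distrib matrix_vector_mult_scaleR scaleR_add_right)
    qed
    with \<open>convex C\<close> show "convex ((\<lambda>w. A i *v ?y + B i *v w) -` C)"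
      by (rule convex_affine_vimage)
    have "infnorm (H i (Suc t) *v x) \<le> 1"
      using Suc.prems(1)[of "Suc t"] by (simp add: lin_region_def)
    then show "sat (K i *v ?y) $ j \<in> closed_segment ((K i *v ?y) $ j) ((H i (Suc t) *v x) $ j)" for j
      by (intro sat_in_closed_segment order_trans[OF component_le_infnorm_cart])
  qed
  then show ?case by (simp add: sat_system_def[of _ _ _ _ ?y])
qed

text \<open>The bound is confined to the unit sublevel of \<open>M\<close>, since this is where the auxiliary
  feedbacks \<open>H\<close> are known to respect the saturation limits.\<close>

definition contracting :: "real \<Rightarrow> real^'n^'n \<Rightarrow> real^'n^'n \<Rightarrow> (real^'n \<Rightarrow> real^'n) \<Rightarrow> bool" where
  "contracting c M Q g \<longleftrightarrow> (\<forall>x. quad M x \<le> 1 \<longrightarrow> quad Q (g x) \<le> c * quad M x)"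

lemma contracting_mono:
  assumes "contracting c M Q g" "c \<le> d" "sym_pos_def M"
  shows "contracting d M Q g"
  using assms unfolding contracting_def by (meson mult_right_mono order_trans quad_nonneg)

text \<open>Sublevel sets of a positive definite quadratic form are convex, so a bound on all the linear
  maps \<open>E\<^sup>t\<close> passes to the saturated iterates that they cover.\<close>

lemma sat_iterate_contracting:
  fixes K :: "nat \<Rightarrow> real^'n^'m"
  assumes M: "sym_pos_def M" and Q: "sym_pos_def Q"
    and region: "\<And>s. s \<in> {1..t} \<Longrightarrow> ellipsoid M \<subseteq> lin_region (H i s)"
    and dec: "\<And>x S. x \<noteq> 0 \<Longrightarrow> quad Q (E_fun A B K H i t x S) < quad M x"
  shows "\<exists>c\<in>{0<..<1}. contracting c M Q (sat_system A B K i ^^ t)"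
proof -
  have "\<exists>c\<in>{0<..<1}. \<forall>L \<in> range (\<lambda>S x. E_fun A B K H i t x S). \<forall>x. quad Q (L x) \<le> c * quad M x"
  proof (rule finite_uniform_constant[OF finite_E_fun_maps])
    fix L assume "L \<in> range (\<lambda>S x. E_fun A B K H i t x S)"
    then show "\<exists>c\<in>{0<..<1}. \<forall>x. quad Q (L x) \<le> c * quad M x"
      using linear_E_fun dec by (auto intro!: strict_decrease_imp_contraction[OF M Q])
  next
    fix L and c d :: real
    assume "\<forall>x. quad Q (L x) \<le> c * quad M x" "c \<le> d"
    then show "\<forall>x. quad Q (L x) \<le> d * quad M x"
      by (meson mult_right_mono order_trans quad_nonneg[OF M])
  qed (use dense[of "0::real" 1] in auto)
  then obtain c where c: "c \<in> {0<..<1}"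
    "\<And>S x. quad Q (E_fun A B K H i t x S) \<le> c * quad M x" by auto
  have "(sat_system A B K i ^^ t) x \<in> {y. quad Q y \<le> c * quad M x}" if "quad M x \<le> 1" for x
    using that region c(2) convex_quad_sublevel[OF Q]
    by (intro sat_iterate_in_convex[where H = H]) (auto simp: ellipsoid_def)
  with c(1) show ?thesis unfolding contracting_def by blast
qed

section \<open>Dwell time and decay of the switched Lyapunov function\<close>

lemma dwell_before_switch:
  assumes adm: "dt_admissible N \<tau> \<sigma>" and t: "0 < t" "\<sigma> t \<noteq> \<sigma> (t - 1)"
  shows "\<tau> \<le> t" "\<And>u. t - \<tau> \<le> u \<Longrightarrow> u < t \<Longrightarrow> \<sigma> u = \<sigma> (t - 1)"
proof -
  let ?I = "switching_instants \<sigma>"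
  define s where "s = Max {s \<in> ?I. s < t}"
  have fin: "finite {s \<in> ?I. s < t}" and ne: "{s \<in> ?I. s < t} \<noteq> {}"
    using t(1) by (auto simp: switching_instants_def)
  have s: "s \<in> ?I" "s < t" using Max_in[OF fin ne] by (auto simp: s_def)
  have max: "u \<le> s" if "u \<in> ?I" "u < t" for u
    unfolding s_def using fin that by (intro Max_ge) auto
  have "{s<..<t} \<inter> ?I = {}" using max by force
  moreover have "t \<in> ?I" using t by (simp add: switching_instants_def)
  ultimately have \<tau>: "\<tau> \<le> t - s" using adm s by (auto simp: dt_admissible_def)
  then show "\<tau> \<le> t" by simp
  have const: "s + k < t \<Longrightarrow> \<sigma> (s + k) = \<sigma> s" for k
  proof (induction k)
    case (Suc k)
    then have "s + Suc k \<notin> ?I" using max[of "s + Suc k"] by auto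
    then show ?case using Suc by (simp add: switching_instants_def)
  qed simp
  show "\<sigma> u = \<sigma> (t - 1)" if "t - \<tau> \<le> u" "u < t" for u
    using const[of "u - s"] const[of "t - 1 - s"] that \<tau> s(2) by simp
qed

lemma trajectory_constant_mode:
  assumes "\<And>u. s \<le> u \<Longrightarrow> u < s + k \<Longrightarrow> \<sigma> u = i"
  shows "trajectory f \<sigma> x (s + k) = (f i ^^ k) (trajectory f \<sigma> x s)"
  using assms by (induction k) simp_all

text \<open>The two hypotheses bound \<open>V t\<close> by earlier values with the rate \<open>\<mu>\<close> per unit of time: over one
  step if there is no switch, and over the \<open>\<tau>\<close> steps that precede a switch. Both are available only
  inside the unit sublevel, which the bound itself never leaves.\<close>

lemma dwell_time_decay:
  fixes V :: "nat \<Rightarrow> real"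
  assumes \<mu>: "0 < \<mu>" "\<mu> \<le> 1" and \<tau>: "1 \<le> \<tau>" and V0: "0 \<le> V 0" "V 0 \<le> 1"
    and adm: "dt_admissible N \<tau> \<sigma>"
    and stay: "\<And>t. \<sigma> (Suc t) = \<sigma> t \<Longrightarrow> V t \<le> 1 \<Longrightarrow> V (Suc t) \<le> \<mu> * V t"
    and switch: "\<And>s i. (\<And>u. s \<le> u \<Longrightarrow> u < s + \<tau> \<Longrightarrow> \<sigma> u = i) \<Longrightarrow> \<sigma> (s + \<tau>) \<noteq> i \<Longrightarrow> V s \<le> 1
                   \<Longrightarrow> V (s + \<tau>) \<le> \<mu> ^ \<tau> * V s"
  shows "V t \<le> \<mu> ^ t * V 0"
proof (induction t rule: less_induct)
  case (less t)
  have rate: "\<mu> ^ u * V 0 \<le> 1" for u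
    using \<mu> V0 by (intro mult_le_one power_le_one) auto
  show ?case
  proof (cases "t = 0")
    case False
    show ?thesis
    proof (cases "\<sigma> t = \<sigma> (t - 1)")
      case True
      have "V (t - 1) \<le> \<mu> ^ (t - 1) * V 0" using less False by simp
      moreover from this have "V t \<le> \<mu> * V (t - 1)"
        using stay[of "t - 1"] True False rate[of "t - 1"] by simp
      ultimately have "V t \<le> \<mu> * (\<mu> ^ (t - 1) * V 0)"
        using \<mu>(1) by (meson less_imp_le mult_left_mono order_trans)
      then show ?thesis using False by (simp flip: power_Suc mult.assoc)
    next
      case switched: False
      note dwell = dwell_before_switch[OF adm _ switched]
      have le: "\<tau> \<le> t" using dwell(1) False by simp
      have "V (t - \<tau>) \<le> \<mu> ^ (t - \<tau>) * V 0" using less False \<tau> by simp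
      moreover from this have "V t \<le> \<mu> ^ \<tau> * V (t - \<tau>)"
        using switch[of "t - \<tau>" "\<sigma> (t - 1)"] dwell(2) switched False le rate[of "t - \<tau>"] by simp
      ultimately have "V t \<le> \<mu> ^ \<tau> * (\<mu> ^ (t - \<tau>) * V 0)"
        using \<mu>(1) by (meson less_imp_le mult_left_mono order_trans zero_less_power)
      then show ?thesis using le by (simp flip: power_add mult.assoc)
    qed
  qed simp
qed

section \<open>Local stability and the domain of attraction\<close>

theorem theorem2:
  fixes N \<tau> :: nat
    and A :: "nat \<Rightarrow> real^'n^'n"
    and B :: "nat \<Rightarrow> real^'m^'n"
    and K :: "nat \<Rightarrow> real^'n^'m"
    and P :: "nat \<Rightarrow> real^'n^'n"
    and H :: "nat \<Rightarrow> nat \<Rightarrow> real^'n^'m"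
  assumes "1 \<le> N" and "1 \<le> \<tau>"
    and "\<forall>i\<in>{1..N}. schur_stable (A i + B i ** K i)"
    and "dt_loc_asymp_stable N \<tau> (unsat_system A B K)"
    and "\<forall>i\<in>{1..N}. sym_pos_def (P i)"
    and "\<forall>x i. \<forall>S :: nat \<Rightarrow> 'm set. x \<noteq> 0 \<longrightarrow> i \<in> {1..N} \<longrightarrow>
           E_fun A B K H i 1 x S \<bullet> (P i *v E_fun A B K H i 1 x S) - x \<bullet> (P i *v x) < 0"
    and "\<forall>x i j. \<forall>S :: nat \<Rightarrow> 'm set. x \<noteq> 0 \<longrightarrow> i \<in> {1..N} \<longrightarrow> j \<in> {1..N} \<longrightarrow> i \<noteq> j \<longrightarrow>
           E_fun A B K H i \<tau> x S \<bullet> (P j *v E_fun A B K H i \<tau> x S) - x \<bullet> (P i *v x) < 0"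
    and "\<forall>i\<in>{1..N}. \<forall>t\<in>{1..\<tau>}. ellipsoid (P i) \<subseteq> lin_region (H i t)"
  shows "dt_loc_asymp_stable N \<tau> (sat_system A B K) \<and>
         (\<Inter>i\<in>{1..N}. ellipsoid (P i)) \<subseteq> dt_domain_of_attraction N \<tau> (sat_system A B K)"
proof -
  note pd = assms(5)[rule_format]
  let ?f = "sat_system A B K"
  \<comment> \<open>Staying in a mode contracts in one step, changing the mode in \<open>\<tau>\<close> steps.\<close>
  let ?dur = "\<lambda>(i, j). if i = j then 1 else \<tau>"
  have "\<exists>c\<in>{0<..<1}. \<forall>ij\<in>{1..N} \<times> {1..N}.
      contracting c (P (fst ij)) (P (snd ij)) (?f (fst ij) ^^ ?dur ij)"
  proof (rule finite_uniform_constant)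
    fix ij assume "ij \<in> {1..N} \<times> {1..N}"
    then obtain i j where ij: "ij = (i, j)" "i \<in> {1..N}" "j \<in> {1..N}" by auto
    have "\<exists>c\<in>{0<..<1}. contracting c (P i) (P j) (?f i ^^ ?dur (i, j))"
    proof (rule sat_iterate_contracting[OF pd pd])
      show "ellipsoid (P i) \<subseteq> lin_region (H i s)" if "s \<in> {1..?dur (i, j)}" for s
        using assms(2,8) ij that by (cases "i = j") auto
      show "quad (P j) (E_fun A B K H i (?dur (i, j)) x S) < quad (P i) x" if "x \<noteq> 0" for x S
        using assms(6,7) ij that by (cases "i = j") auto
    qed (use ij in auto)
    then show "\<exists>c\<in>{0<..<1}. contracting c (P (fst ij)) (P (snd ij)) (?f (fst ij) ^^ ?dur ij)"
      using ij(1) by simp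
  next
    show "contracting d (P (fst ij)) (P (snd ij)) (?f (fst ij) ^^ ?dur ij)"
      if "ij \<in> {1..N} \<times> {1..N}" "c \<le> d"
        "contracting c (P (fst ij)) (P (snd ij)) (?f (fst ij) ^^ ?dur ij)" for ij and c d :: real
      using that pd by (auto intro: contracting_mono)
  qed (use dense[of "0::real" 1] in auto)
  then obtain c where c: "0 < c" "c < 1"
    and contr: "\<And>i j. i \<in> {1..N} \<Longrightarrow> j \<in> {1..N} \<Longrightarrow> contracting c (P i) (P j) (?f i ^^ ?dur (i, j))"
    by force
  \<comment> \<open>The rate is chosen so that \<open>\<tau>\<close> steps at this rate give the contraction across a switch.\<close>
  define \<mu> where "\<mu> = root \<tau> c"
  have \<mu>: "0 < \<mu>" "\<mu> < 1" "\<mu> ^ \<tau> = c"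
    using c assms(2) by (simp_all add: \<mu>_def)
  then have "c \<le> \<mu>"
    using power_decreasing[of 1 \<tau> \<mu>] assms(2) by simp
  have decay: "quad (P (\<sigma> t)) (trajectory ?f \<sigma> x t) \<le> \<mu> ^ t * quad (P (\<sigma> 0)) x"
    if adm: "dt_admissible N \<tau> \<sigma>" and x: "quad (P (\<sigma> 0)) x \<le> 1" for \<sigma> x t
  proof -
    have mode: "\<sigma> t \<in> {1..N}" for t using adm by (simp add: dt_admissible_def)
    define V where "V t = quad (P (\<sigma> t)) (trajectory ?f \<sigma> x t)" for t
    have V_nonneg: "0 \<le> V t" for t using quad_nonneg[OF pd[OF mode]] by (simp add: V_def)
    have "V t \<le> \<mu> ^ t * V 0"
    proof (rule dwell_time_decay[OF \<mu>(1) less_imp_le[OF \<mu>(2)] assms(2) _ _ adm])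
      fix t assume "\<sigma> (Suc t) = \<sigma> t" "V t \<le> 1"
      then have "V (Suc t) \<le> c * V t"
        using contr[OF mode[of t] mode[of t]] by (simp add: V_def contracting_def)
      also have "\<dots> \<le> \<mu> * V t"
        using \<open>c \<le> \<mu>\<close> V_nonneg by (intro mult_right_mono)
      finally show "V (Suc t) \<le> \<mu> * V t" .
    next
      fix s i
      assume i: "\<And>u. s \<le> u \<Longrightarrow> u < s + \<tau> \<Longrightarrow> \<sigma> u = i" "\<sigma> (s + \<tau>) \<noteq> i" and "V s \<le> 1"
      have "\<sigma> s = i" using i(1)[of s] assms(2) by simp
      moreover have "trajectory ?f \<sigma> x (s + \<tau>) = (?f i ^^ \<tau>) (trajectory ?f \<sigma> x s)"
        by (rule trajectory_constant_mode) (rule i(1))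
      ultimately show "V (s + \<tau>) \<le> \<mu> ^ \<tau> * V s"
        using contr[OF mode[of s] mode[of "s + \<tau>"]] i(2) \<open>V s \<le> 1\<close>
        by (simp add: V_def contracting_def \<mu>(3))
    qed (use x V_nonneg[of 0] in \<open>simp_all add: V_def\<close>)
    then show ?thesis by (simp add: V_def)
  qed
  have "\<exists>a\<in>{0<..}. \<forall>i\<in>{1..N}. \<forall>x. (norm x)\<^sup>2 \<le> a * quad (P i) x"
    by (rule finite_uniform_constant)
      (use quad_norm_equivalent(1)[OF pd] in
        \<open>auto intro: order_trans[OF _ mult_right_mono[OF _ quad_nonneg[OF pd]]]\<close>)
  then obtain a where a: "0 < a" "\<And>i x. i \<in> {1..N} \<Longrightarrow> (norm x)\<^sup>2 \<le> a * quad (P i) x" by auto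
  have "\<exists>b\<in>{0<..}. \<forall>i\<in>{1..N}. \<forall>x. quad (P i) x \<le> b * (norm x)\<^sup>2"
    by (rule finite_uniform_constant)
      (use quad_norm_equivalent(2)[OF pd] in
        \<open>auto intro: order_trans[OF _ mult_right_mono[OF _ zero_le_power2]]\<close>)
  then obtain b where b: "0 < b" "\<And>i x. i \<in> {1..N} \<Longrightarrow> quad (P i) x \<le> b * (norm x)\<^sup>2" by auto
  have norm_decay: "(norm (trajectory ?f \<sigma> x t))\<^sup>2 \<le> a * (\<mu> ^ t * quad (P (\<sigma> 0)) x)"
    if "dt_admissible N \<tau> \<sigma>" "quad (P (\<sigma> 0)) x \<le> 1" for \<sigma> x t
  proof -
    have "\<sigma> t \<in> {1..N}" using that(1) by (simp add: dt_admissible_def)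
    then show ?thesis
      using a(2) decay[OF that] mult_left_mono a(1) by (meson less_imp_le order_trans)
  qed
  have attraction: "trajectory ?f \<sigma> x \<longlonglongrightarrow> 0"
    if "dt_admissible N \<tau> \<sigma>" "quad (P (\<sigma> 0)) x \<le> 1" for \<sigma> x
  proof -
    have "(\<lambda>t. \<mu> ^ t) \<longlonglongrightarrow> 0" using \<mu> by (intro LIMSEQ_realpow_zero) auto
    then have "(\<lambda>t. a * (\<mu> ^ t * quad (P (\<sigma> 0)) x)) \<longlonglongrightarrow> 0"
      by (intro tendsto_mult_right_zero tendsto_mult_left_zero)
    then have "(\<lambda>t. (norm (trajectory ?f \<sigma> x t))\<^sup>2) \<longlonglongrightarrow> 0"
      by (rule Lim_null_comparison[rotated]) (simp add: norm_decay[OF that])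
    then show ?thesis
      by (simp add: tendsto_norm_zero_iff)
  qed
  have stability: "loc_asymp_stable ?f \<sigma>" if adm: "dt_admissible N \<tau> \<sigma>" for \<sigma>
  proof -
    have mode: "\<sigma> 0 \<in> {1..N}" using adm by (simp add: dt_admissible_def)
    define \<delta> where "\<delta> = 1 / sqrt b"
    have \<delta>: "0 < \<delta>" using b(1) by (simp add: \<delta>_def)
    have small: "quad (P (\<sigma> 0)) x \<le> 1" if "norm x < \<delta>" for x
    proof -
      have "(norm x)\<^sup>2 \<le> \<delta>\<^sup>2" using that by (intro power_mono) auto
      then have "b * (norm x)\<^sup>2 \<le> 1" using b(1) by (simp add: \<delta>_def power_divide field_simps)
      then show ?thesis using b(2)[OF mode] order_trans by blast
    qed
    have "\<exists>d>0. \<forall>x. norm x < d \<longrightarrow> (\<forall>t. norm (trajectory ?f \<sigma> x t) < \<epsilon>)" if "0 < \<epsilon>" for \<epsilon>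
    proof (intro exI[of _ "min \<delta> (\<epsilon> / sqrt (a * b))"] conjI allI impI)
      show "0 < min \<delta> (\<epsilon> / sqrt (a * b))" using \<delta> a(1) b(1) that by simp
      fix x :: "real^'n" and t
      assume x: "norm x < min \<delta> (\<epsilon> / sqrt (a * b))"
      then have le1: "quad (P (\<sigma> 0)) x \<le> 1" using small by simp
      have "(norm (trajectory ?f \<sigma> x t))\<^sup>2 \<le> a * (\<mu> ^ t * quad (P (\<sigma> 0)) x)"
        by (rule norm_decay[OF adm le1])
      also have "\<dots> \<le> a * quad (P (\<sigma> 0)) x"
        using a(1) \<mu> quad_nonneg[OF pd[OF mode]]
        by (intro mult_left_mono mult_left_le_one_le power_le_one) auto
      also have "\<dots> \<le> a * (b * (norm x)\<^sup>2)"
        using a(1) b(2)[OF mode] by (intro mult_left_mono) auto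
      also have "\<dots> = (sqrt (a * b) * norm x)\<^sup>2"
        using a(1) b(1) by (simp add: power_mult_distrib)
      finally have "norm (trajectory ?f \<sigma> x t) \<le> sqrt (a * b) * norm x"
        using a(1) b(1) by (simp add: power2_le_iff_abs_le)
      also have "\<dots> < \<epsilon>" using x a(1) b(1) by (simp add: field_simps)
      finally show "norm (trajectory ?f \<sigma> x t) < \<epsilon>" .
    qed
    then show ?thesis
      unfolding loc_asymp_stable_def using \<delta> small attraction[OF adm] by blast
  qed
  have "x \<in> dt_domain_of_attraction N \<tau> ?f" if "x \<in> (\<Inter>i\<in>{1..N}. ellipsoid (P i))" for x
    using that attraction by (auto simp: dt_domain_of_attraction_def dt_admissible_def ellipsoid_def)
  with stability show ?thesis
    unfolding dt_loc_asymp_stable_def by blast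
qed

end
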